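(* Let $(X_1,X_2,X_3)$ have standard exponential margins and joint density $f$ given by the trivariate vine copula with pair copulas $C_{12}$, $C_{23}$, $C_{13|2}$, each of which is an inverted extreme value copula, with exponent measures $V^{\{12\}},V^{\{23\}},V^{\{13|2\}}$ respectively. Then the gauge function of $f$ is $$g(\mathbf x)=x_2+V^{\{13|2\}}\left[\left\{V^{\{12\}}(x_1^{-1},x_2^{-1})-x_2\right\}^{-1},\left\{V^{\{23\}}(x_2^{-1},x_3^{-1})-x_2\right\}^{-1}\right],\qquad x_1,x_2,x_3\ge0.$$
   Context: The gauge function of $f$ is the function $g$, homogeneous of order 1, with $-\ln f(t\mathbf x)\sim t g(\mathbf x)$ as $t\to\infty$, where $\mathbf x=(x_1,x_2,x_3)$. Exponent measure: $V(x,y)=2\int_0^1\max\left(\frac wx,\frac{1-w}{y}\right)dH(w)$, $x,y>0$, where the spectral distribution $H$ is a probability distribution on $[0,1]$ with $\int_0^1 w\,dH(w)=1/2$. The derivatives $V_1,V_2,V_{12}$ of $V$ with respect to the first, second and both arguments are assumed to exist. Reciprocals of $0$ are read as $\infty$, with $V$ then evaluated by the same integral (with $w/\infty=(1-w)/\infty=0$). Inverted extreme value copula with exponent measure $V$: $C(u,v)=u+v-1+\exp\left[-V\left\{\frac{-1}{\ln(1-u)},\frac{-1}{\ln(1-v)}\right\}\right]$, with density $c=\partial^2C/\partial u\,\partial v$. Trivariate vine: with $F_i(x)=1-e^{-x}$, $f_i(x)=e^{-x}$, $F_{1|2}(x_1|x_2)=\partial_2C_{12}\{F_1(x_1),F_2(x_2)\}$,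 $F_{3|2}(x_3|x_2)=\partial_1C_{23}\{F_2(x_2),F_3(x_3)\}$, $$f(x_1,x_2,x_3)=f_1(x_1)f_2(x_2)f_3(x_3)\,c_{12}\{F_1(x_1),F_2(x_2)\}\,c_{23}\{F_2(x_2),F_3(x_3)\}\,c_{13|2}\{F_{1|2}(x_1|x_2),F_{3|2}(x_3|x_2)\}.$$
   Formalization: It is additionally assumed that f is positive for all x1, x2, x3 > 0 and that the mixed derivative V_12 of V^{13|2} is continuous; −ln f(tx) ~ t g(x) is proved for x1, x2, x3 > 0, and g on the boundary faces is determined by continuity. *)

theory Defs
  imports "HOL-Probability.Probability"
begin

definition spectral_distribution :: "real measure \<Rightarrow> bool" where
  "spectral_distribution H \<longleftrightarrow>
     real_distribution H \<and> measure H {0..1} = 1 \<and> (LINT w|H. w) = 1 / 2"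

(* The arguments are extended reals so that V is also defined when one of them is \<infinity>, the
   reciprocal of 0: in ereal, inverse 0 = \<infinity> and w / \<infinity> = 0. For arguments in (0, \<infinity>] the
   integrand is finite for every w. *)
definition exponent_measure :: "real measure \<Rightarrow> ereal \<Rightarrow> ereal \<Rightarrow> real" where
  "exponent_measure H x y =
     2 * (LINT w|H. real_of_ereal (max (ereal w / x) (ereal (1 - w) / y)))"

definition D1 :: "(real \<Rightarrow> real \<Rightarrow> real) \<Rightarrow> real \<Rightarrow> real \<Rightarrow> real" where
  "D1 \<phi> x y = deriv (\<lambda>s. \<phi> s y) x"

definition D2 :: "(real \<Rightarrow> real \<Rightarrow> real) \<Rightarrow> real \<Rightarrow> real \<Rightarrow> real" where
  "D2 \<phi> x y = deriv (\<lambda>s. \<phi> x s) y"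

definition D12 :: "(real \<Rightarrow> real \<Rightarrow> real) \<Rightarrow> real \<Rightarrow> real \<Rightarrow> real" where
  "D12 \<phi> = D1 (D2 \<phi>)"

definition V_real :: "real measure \<Rightarrow> real \<Rightarrow> real \<Rightarrow> real" where
  "V_real H x y = exponent_measure H (ereal x) (ereal y)"

definition V_derivatives_exist :: "real measure \<Rightarrow> bool" where
  "V_derivatives_exist H \<longleftrightarrow> (\<forall>x>0. \<forall>y>0.
     (\<lambda>s. V_real H s y) field_differentiable (at x) \<and>
     (\<lambda>s. V_real H x s) field_differentiable (at y) \<and>
     (\<lambda>s. D2 (V_real H) s y) field_differentiable (at x))"

(* Only meant for 0 < u < 1 and 0 < v < 1. *)
definition inverted_EV_copula :: "real measure \<Rightarrow> real \<Rightarrow> real \<Rightarrow> real" where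
  "inverted_EV_copula H u v =
     u + v - 1 + exp (- V_real H (- 1 / ln (1 - u)) (- 1 / ln (1 - v)))"

definition inverted_EV_copula_density :: "real measure \<Rightarrow> real \<Rightarrow> real \<Rightarrow> real" where
  "inverted_EV_copula_density H = D12 (inverted_EV_copula H)"

definition exp_cdf :: "real \<Rightarrow> real" where
  "exp_cdf x = 1 - exp (- x)"

definition exp_pdf :: "real \<Rightarrow> real" where
  "exp_pdf x = exp (- x)"

definition cond_cdf_1_given_2 :: "real measure \<Rightarrow> real \<Rightarrow> real \<Rightarrow> real" where
  "cond_cdf_1_given_2 H12 x1 x2 = D2 (inverted_EV_copula H12) (exp_cdf x1) (exp_cdf x2)"

definition cond_cdf_3_given_2 :: "real measure \<Rightarrow> real \<Rightarrow> real \<Rightarrow> real" where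
  "cond_cdf_3_given_2 H23 x3 x2 = D1 (inverted_EV_copula H23) (exp_cdf x2) (exp_cdf x3)"

definition pos_orthant :: "(real \<times> real \<times> real) set" where
  "pos_orthant = {0<..} \<times> {0<..} \<times> {0<..}"

definition nonneg_orthant :: "(real \<times> real \<times> real) set" where
  "nonneg_orthant = {0..} \<times> {0..} \<times> {0..}"

(* The copula densities are derivatives on the open unit square, so the product formula only makes
   sense on the open orthant. Its complement is a null set for the joint law. *)
definition vine_density ::
    "real measure \<Rightarrow> real measure \<Rightarrow> real measure \<Rightarrow> real \<times> real \<times> real \<Rightarrow> real" where
  "vine_density H12 H23 H13_2 = (\<lambda>(x1, x2, x3).
     if (x1, x2, x3) \<in> pos_orthant then
       exp_pdf x1 * exp_pdf x2 * exp_pdf x3 *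
       inverted_EV_copula_density H12 (exp_cdf x1) (exp_cdf x2) *
       inverted_EV_copula_density H23 (exp_cdf x2) (exp_cdf x3) *
       inverted_EV_copula_density H13_2
         (cond_cdf_1_given_2 H12 x1 x2) (cond_cdf_3_given_2 H23 x3 x2)
     else 0)"

(* A density of a vector with exponential margins is determined only on the open orthant, and even
   smooth models may have a density vanishing on the boundary faces; the values of a gauge function
   on the faces are fixed by continuity. *)
definition is_gauge_function ::
    "(real \<times> real \<times> real \<Rightarrow> real) \<Rightarrow> (real \<times> real \<times> real \<Rightarrow> real) \<Rightarrow> bool" where
  "is_gauge_function f g \<longleftrightarrow>
     (\<forall>c>0. \<forall>x\<in>nonneg_orthant. g (c *\<^sub>R x) = c * g x) \<and>
     continuous_on nonneg_orthant g \<and>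
     (\<forall>x\<in>pos_orthant. (\<lambda>t. - ln (f (t *\<^sub>R x))) \<sim>[at_top] (\<lambda>t. t * g x))"

end

theory Submission
  imports Defs
begin

text \<open>In exponential coordinates an exponent measure becomes the function \<open>L a b = V (1/a) (1/b)\<close>, which
is homogeneous of order 1, and on the closed quadrant it is nondecreasing and 1-Lipschitz in each
variable with \<open>L a 0 = a\<close> and \<open>L 0 b = b\<close>. The
survival function of an inverted extreme value pair is \<open>exp (- L a b)\<close>, hence its density is
\<open>exp (- L) * (L\<^sub>1 * L\<^sub>2 - L\<^sub>1\<^sub>2)\<close>, and conditioning on the second coordinate turns \<open>1 - F\<close> into
\<open>exp (b - L a b) * L\<^sub>2\<close>.

Along a ray \<open>t * x\<close> the conditional distribution functions therefore equal, on the exponential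
scale, \<open>t * (L a b - b) - ln L\<^sub>2\<close>, where the logarithm does not depend on \<open>t\<close> because \<open>L\<^sub>2\<close> is
homogeneous of order 0. Inserting this into the third copula density and collecting the exponents,
the two conditional terms cancel against the pair densities and
\<open>- ln f (t * x) = t * g x + o(t)\<close>, as long as none of the three factors \<open>L\<^sub>1 * L\<^sub>2 - L\<^sub>1\<^sub>2\<close> tends to 0.
Since \<open>L\<^sub>1\<^sub>2\<close> is homogeneous of order -1 (and continuous for the conditional pair, whose ray is
followed only asymptotically), the limits are the products \<open>L\<^sub>1 * L\<^sub>2\<close>, and the point of the
proof is that positivity of \<open>f\<close> forces these to be positive.

For the two unconditional pairs this is immediate (\<open>density_factor_nonzero_imp\<close>): a zero of \<open>L\<^sub>1\<close> or \<open>L\<^sub>2\<close> is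
a minimum of that function, so there \<open>L\<^sub>1\<^sub>2\<close> vanishes as well and the density would be 0. For the
conditional pair the density is known to be positive only at the points reached by the conditional
distribution functions. However, a zero of \<open>L\<^sub>1\<close> or \<open>L\<^sub>2\<close> propagates to a whole sector
bounded by an axis
(\<open>partial1_eq_0_downward\<close>, \<open>partial2_eq_0_upward\<close>), and because either conditional coordinate can be
made arbitrarily small while the other stays fixed, every sector of this kind contains such a point
(\<open>cond_partial1_pos\<close>, \<open>cond_partial2_pos\<close>).

By homogeneity, all of this is expressed through the single function \<open>s \<mapsto> L s 1\<close>. The closed form
of \<open>g\<close> is a composition of Lipschitz functions, which gives its continuity up to the boundary.\<close>

section \<open>The stable tail dependence function\<close>

definition tail_dep :: "real measure \<Rightarrow> real \<Rightarrow> real \<Rightarrow> real" where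
  "tail_dep H a b = 2 * (LINT w|H. max (w * a) ((1 - w) * b))"

lemma spectral_AE:
  assumes "spectral_distribution H"
  shows "AE w in H. w \<in> {0..1}"
proof -
  interpret real_distribution H using assms by (simp add: spectral_distribution_def)
  show ?thesis
    using assms by (subst prob_eq_1 [symmetric]) (auto simp: spectral_distribution_def)
qed

lemma spectral_integrable:
  assumes "spectral_distribution H" "h \<in> borel_measurable borel"
    and "\<And>w. w \<in> {0..1} \<Longrightarrow> \<bar>h w\<bar> \<le> B"
  shows "integrable H (h :: real \<Rightarrow> real)"
proof -
  interpret real_distribution H using assms by (simp add: spectral_distribution_def)
  show ?thesis
    using assms(2)
  proof (intro integrable_const_bound [where B = B])
    show "AE w in H. norm (h w) \<le> B"
      using spectral_AE [OF assms(1)] by eventually_elim (simp add: assms(3))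
  qed simp
qed

lemma spectral_integrable_max:
  assumes "spectral_distribution H"
  shows "integrable H (\<lambda>w. max (w * a) ((1 - w) * b))"
proof (rule spectral_integrable [OF assms, where B = "\<bar>a\<bar> + \<bar>b\<bar>"])
  fix w :: real assume "w \<in> {0..1}"
  then have "\<bar>w * a\<bar> \<le> \<bar>a\<bar>" "\<bar>(1 - w) * b\<bar> \<le> \<bar>b\<bar>"
    by (auto simp: abs_mult mult_left_le_one_le)
  then show "\<bar>max (w * a) ((1 - w) * b)\<bar> \<le> \<bar>a\<bar> + \<bar>b\<bar>" by linarith
qed simp

lemma spectral_integrable_id:
  assumes "spectral_distribution H"
  shows "integrable H (\<lambda>w. w)"
  by (rule spectral_integrable [OF assms, where B = 1]) auto

lemma spectral_integrable_affine:
  assumes "spectral_distribution H"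
  shows "integrable H (\<lambda>w. w * a + (1 - w) * b)"
proof (rule spectral_integrable [OF assms, where B = "\<bar>a\<bar> + \<bar>b\<bar>"])
  fix w :: real assume "w \<in> {0..1}"
  then have "\<bar>w * a\<bar> \<le> \<bar>a\<bar>" "\<bar>(1 - w) * b\<bar> \<le> \<bar>b\<bar>"
    by (auto simp: abs_mult mult_left_le_one_le)
  then show "\<bar>w * a + (1 - w) * b\<bar> \<le> \<bar>a\<bar> + \<bar>b\<bar>" by linarith
qed simp

text \<open>The mean constraint on the spectral distribution enters the proof only here: it makes both margins
of the exponent measure standard.\<close>

lemma spectral_mean:
  assumes "spectral_distribution H"
  shows "(LINT w|H. w * a + (1 - w) * b) = (a + b) / 2"
proof -
  interpret real_distribution H using assms by (simp add: spectral_distribution_def)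
  have "(LINT w|H. w * a + (1 - w) * b) = (LINT w|H. b + w * (a - b))"
    by (rule Bochner_Integration.integral_cong) (auto simp: algebra_simps)
  also have "\<dots> = (LINT w|H. b) + (LINT w|H. w * (a - b))"
    using spectral_integrable_id [OF assms] by (intro Bochner_Integration.integral_add) auto
  also have "\<dots> = b + 1 / 2 * (a - b)"
    using assms prob_space by (simp add: spectral_distribution_def)
  finally show ?thesis by (simp add: field_simps)
qed

text \<open>The convention \<open>w / \<infinity> = 0\<close> is what makes this hold on the faces too, where a reciprocal is infinite.\<close>

lemma exponent_measure_inverse:
  assumes "a \<ge> 0" "b \<ge> 0"
  shows "exponent_measure H (inverse (ereal a)) (inverse (ereal b)) = tail_dep H a b"
proof -
  have div: "ereal w / inverse (ereal c) = ereal (w * c)" for w c :: real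
    by (cases "c = 0") (auto simp: field_simps)
  have "real_of_ereal (max (ereal w / inverse (ereal a)) (ereal (1 - w) / inverse (ereal b)))
      = max (w * a) ((1 - w) * b)" for w
    unfolding div by (simp add: max_def)
  then show ?thesis
    by (simp add: exponent_measure_def tail_dep_def)
qed

lemma V_real_eq_tail_dep:
  assumes "x > 0" "y > 0"
  shows "V_real H x y = tail_dep H (1 / x) (1 / y)"
proof -
  have "ereal x = inverse (ereal (1 / x))" "ereal y = inverse (ereal (1 / y))"
    using assms by auto
  then show ?thesis
    using assms exponent_measure_inverse [of "1 / x" "1 / y" H] by (simp add: V_real_def)
qed

lemma tail_dep_homogeneous:
  assumes "c \<ge> 0"
  shows "tail_dep H (c * a) (c * b) = c * tail_dep H a b"
proof -
  have "max (w * (c * a)) ((1 - w) * (c * b)) = c * max (w * a) ((1 - w) * b)" for w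
    using assms by (simp add: max_mult_distrib_left mult.left_commute)
  then show ?thesis by (simp add: tail_dep_def)
qed

lemma tail_dep_mono:
  assumes "spectral_distribution H" "a \<le> a'" "b \<le> b'"
  shows "tail_dep H a b \<le> tail_dep H a' b'"
proof -
  have "(LINT w|H. max (w * a) ((1 - w) * b)) \<le> (LINT w|H. max (w * a') ((1 - w) * b'))"
  proof (rule integral_mono_AE)
    show "AE w in H. max (w * a) ((1 - w) * b) \<le> max (w * a') ((1 - w) * b')"
      using spectral_AE [OF assms(1)]
      by eventually_elim (intro max.mono mult_left_mono, use assms in auto)
  qed (intro spectral_integrable_max assms)+
  then show ?thesis by (simp add: tail_dep_def)
qed

text \<open>The increment of the integrand is at most \<open>w * (a' - a) + (1 - w) * (b' - b)\<close>, and both weights have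
mean 1/2. This bound replaces convexity in all that follows.\<close>

lemma tail_dep_lipschitz:
  assumes "spectral_distribution H" "a \<le> a'" "b \<le> b'"
  shows "tail_dep H a' b' \<le> tail_dep H a b + (a' - a) + (b' - b)"
proof -
  note int = spectral_integrable_max [OF assms(1)] spectral_integrable_affine [OF assms(1)]
  have "(LINT w|H. max (w * a') ((1 - w) * b'))
      \<le> (LINT w|H. max (w * a) ((1 - w) * b) + (w * (a' - a) + (1 - w) * (b' - b)))"
  proof (rule integral_mono_AE)
    show "AE w in H. max (w * a') ((1 - w) * b')
        \<le> max (w * a) ((1 - w) * b) + (w * (a' - a) + (1 - w) * (b' - b))"
      using spectral_AE [OF assms(1)]
    proof eventually_elim
      case (elim w)
      then have "w * (a' - a) \<ge> 0" "(1 - w) * (b' - b) \<ge> 0" using assms by auto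
      moreover have "w * a' = w * a + w * (a' - a)" "(1 - w) * b' = (1 - w) * b + (1 - w) * (b' - b)"
        by (simp_all add: algebra_simps)
      ultimately show ?case by linarith
    qed
  qed (intro int Bochner_Integration.integrable_add)+
  also have "\<dots> = (LINT w|H. max (w * a) ((1 - w) * b)) + ((a' - a) + (b' - b)) / 2"
    unfolding spectral_mean [OF assms(1), symmetric]
    by (intro int Bochner_Integration.integral_add)
  finally have "2 * (LINT w|H. max (w * a') ((1 - w) * b'))
      \<le> 2 * ((LINT w|H. max (w * a) ((1 - w) * b)) + ((a' - a) + (b' - b)) / 2)"
    by (rule mult_left_mono) simp
  then show ?thesis by (simp only: tail_dep_def [symmetric] distrib_left) (simp add: field_simps)
qed

lemma tail_dep_right_0:
  assumes "spectral_distribution H" "a \<ge> 0"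
  shows "tail_dep H a 0 = a"
proof -
  have "(LINT w|H. max (w * a) ((1 - w) * 0)) = (LINT w|H. w * a + (1 - w) * 0)"
  proof (rule integral_cong_AE)
    show "AE w in H. max (w * a) ((1 - w) * 0) = w * a + (1 - w) * 0"
      using spectral_AE [OF assms(1)] by eventually_elim (use assms in auto)
  qed (rule borel_measurable_integrable, rule spectral_integrable_max [OF assms(1)],
      rule borel_measurable_integrable, rule spectral_integrable_affine [OF assms(1)])
  then show ?thesis
    by (simp only: tail_dep_def spectral_mean [OF assms(1)]) simp
qed

lemma tail_dep_left_0:
  assumes "spectral_distribution H" "b \<ge> 0"
  shows "tail_dep H 0 b = b"
proof -
  have "(LINT w|H. max (w * 0) ((1 - w) * b)) = (LINT w|H. w * 0 + (1 - w) * b)"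
  proof (rule integral_cong_AE)
    show "AE w in H. max (w * 0) ((1 - w) * b) = w * 0 + (1 - w) * b"
      using spectral_AE [OF assms(1)] by eventually_elim (use assms in auto)
  qed (rule borel_measurable_integrable, rule spectral_integrable_max [OF assms(1)],
      rule borel_measurable_integrable, rule spectral_integrable_affine [OF assms(1)])
  then show ?thesis
    by (simp only: tail_dep_def spectral_mean [OF assms(1)]) simp
qed

lemma tail_dep_ge:
  assumes "spectral_distribution H" "a \<ge> 0" "b \<ge> 0"
  shows "tail_dep H a b \<ge> a" "tail_dep H a b \<ge> b"
  using tail_dep_mono [of H a a 0 b] tail_dep_mono [of H 0 a b b]
    tail_dep_right_0 [of H a] tail_dep_left_0 [of H b] assms by auto

lemma continuous_tail_dep:
  assumes "spectral_distribution H"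
  shows "continuous_on UNIV (\<lambda>(a, b). tail_dep H a b)"
proof -
  have 1: "\<bar>tail_dep H a b - tail_dep H a' b\<bar> \<le> \<bar>a - a'\<bar>" for a b a'
    using tail_dep_lipschitz [OF assms, of a a' b b] tail_dep_lipschitz [OF assms, of a' a b b]
      tail_dep_mono [OF assms, of a a' b b] tail_dep_mono [OF assms, of a' a b b]
    by (cases "a \<le> a'") auto
  have 2: "\<bar>tail_dep H a b - tail_dep H a b'\<bar> \<le> \<bar>b - b'\<bar>" for a b b'
    using tail_dep_lipschitz [OF assms, of a a b b'] tail_dep_lipschitz [OF assms, of a a b' b]
      tail_dep_mono [OF assms, of a a b b'] tail_dep_mono [OF assms, of a a b' b]
    by (cases "b \<le> b'") auto
  have bound: "\<bar>tail_dep H a b - tail_dep H a' b'\<bar> \<le> \<bar>a - a'\<bar> + \<bar>b - b'\<bar>" for a b a' b'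
    using 1 [of a b a'] 2 [of a' b b'] by linarith
  have "2-lipschitz_on UNIV (\<lambda>(a, b). tail_dep H a b)"
  proof (rule lipschitz_onI)
    fix x y :: "real \<times> real"
    have "\<bar>fst x - fst y\<bar> \<le> dist x y" "\<bar>snd x - snd y\<bar> \<le> dist x y"
      using dist_fst_le [of x y] dist_snd_le [of x y] by (simp_all add: dist_real_def)
    then show "dist (case x of (a, b) \<Rightarrow> tail_dep H a b) (case y of (a, b) \<Rightarrow> tail_dep H a b)
        \<le> 2 * dist x y"
      using bound [of "fst x" "snd x" "fst y" "snd y"]
      by (simp add: case_prod_beta dist_real_def)
  qed simp
  then show ?thesis by (rule lipschitz_on_continuous_on)
qed

section \<open>The profile of a smooth exponent measure\<close>

locale smooth_spectral =
  fixes H :: "real measure"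
  assumes spectral: "spectral_distribution H"
    and smooth: "V_derivatives_exist H"
begin

text \<open>By homogeneity the tail dependence function is determined by its restriction to the line \<open>b = 1\<close>.
Its partial derivatives depend on \<open>a / b\<close> only: the first is the derivative of the profile, and the
second is given by Euler's identity (see \<open>DERIV_tail_dep_1\<close> and \<open>DERIV_tail_dep_2\<close>).\<close>

definition profile :: "real \<Rightarrow> real" where "profile s = tail_dep H s 1"
definition partial1 :: "real \<Rightarrow> real" where "partial1 = deriv profile"
definition partial2 :: "real \<Rightarrow> real" where "partial2 s = profile s - s * partial1 s"

lemma tail_dep_eq:
  assumes "b > 0"
  shows "tail_dep H a b = b * profile (a / b)"
  using tail_dep_homogeneous [of b H "a / b" 1] assms by (simp add: profile_def)

lemma V_real_eq:
  assumes "x > 0" "y > 0"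
  shows "V_real H x y = profile (y / x) / y"
  using assms by (simp add: V_real_eq_tail_dep tail_dep_eq field_simps)

lemma DERIV_profile:
  assumes "s > 0"
  shows "(profile has_real_derivative partial1 s) (at s)"
proof -
  have "(\<lambda>x. V_real H x 1) field_differentiable (at (1 / s))"
    using smooth assms by (auto simp: V_derivatives_exist_def)
  then obtain D where D: "((\<lambda>x. V_real H x 1) has_real_derivative D) (at (1 / s))"
    by (auto simp: field_differentiable_def)
  have "((\<lambda>x. 1 / x) has_real_derivative - 1 / s\<^sup>2) (at s)"
    using assms by (auto intro!: derivative_eq_intros simp: power2_eq_square)
  then have "((\<lambda>x. V_real H (1 / x) 1) has_real_derivative D * (- 1 / s\<^sup>2)) (at s)"
    by (rule DERIV_chain2 [where g = "\<lambda>x. 1 / x" and x = s, OF D])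
  then have "(profile has_real_derivative D * (- 1 / s\<^sup>2)) (at s)"
    by (rule has_field_derivative_transform_within_open [where S = "{0<..}"])
      (use assms in \<open>auto simp: V_real_eq\<close>)
  then show ?thesis
    by (metis DERIV_imp_deriv partial1_def)
qed

lemmas DERIV_profile' [derivative_intros] = DERIV_chain2 [OF DERIV_profile]

lemma D2_V_real:
  assumes "x > 0" "y > 0"
  shows "D2 (V_real H) x y = partial1 (y / x) / (x * y) - profile (y / x) / y\<^sup>2"
  unfolding D2_def
proof (rule DERIV_imp_deriv)
  have "((\<lambda>s. profile (s / x) / s)
      has_real_derivative partial1 (y / x) / (x * y) - profile (y / x) / y\<^sup>2) (at y)"
    using assms by (auto intro!: derivative_eq_intros simp: field_simps power2_eq_square)
  then show "(V_real H x
      has_real_derivative partial1 (y / x) / (x * y) - profile (y / x) / y\<^sup>2) (at y)"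
    by (rule has_field_derivative_transform_within_open [where S = "{0<..}"])
      (use assms in \<open>auto simp: V_real_eq\<close>)
qed

text \<open>The derivative of \<open>V\<close> in its second argument contains the derivative of the profile linearly, so the
existence of the mixed derivative of \<open>V\<close> makes the profile twice differentiable. In particular
both partial derivatives are continuous.\<close>

lemma DERIV_partial1:
  assumes "s > 0"
  shows "(partial1 has_real_derivative deriv partial1 s) (at s)"
proof -
  have "(\<lambda>x. D2 (V_real H) x 1) field_differentiable (at (1 / s))"
    using smooth assms by (auto simp: V_derivatives_exist_def)
  then obtain D where D: "((\<lambda>x. D2 (V_real H) x 1) has_real_derivative D) (at (1 / s))"
    by (auto simp: field_differentiable_def)
  have "((\<lambda>x. 1 / x) has_real_derivative - 1 / s\<^sup>2) (at s)"
    using assms by (auto intro!: derivative_eq_intros simp: power2_eq_square)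
  then have *: "((\<lambda>x. D2 (V_real H) (1 / x) 1) has_real_derivative D * (- 1 / s\<^sup>2)) (at s)"
    by (rule DERIV_chain2 [where g = "\<lambda>x. 1 / x" and x = s, OF D])
  have "((\<lambda>x. (D2 (V_real H) (1 / x) 1 + profile x) / x) has_real_derivative
      ((D * (- 1 / s\<^sup>2) + partial1 s) * s - (D2 (V_real H) (1 / s) 1 + profile s)) / s\<^sup>2) (at s)"
    using assms by (auto intro!: derivative_eq_intros * simp: power2_eq_square)
  then have "(partial1 has_real_derivative
      ((D * (- 1 / s\<^sup>2) + partial1 s) * s - (D2 (V_real H) (1 / s) 1 + profile s)) / s\<^sup>2) (at s)"
    by (rule has_field_derivative_transform_within_open [where S = "{0<..}"])
      (use assms in \<open>auto simp: D2_V_real\<close>)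
  then show ?thesis
    by (metis DERIV_imp_deriv)
qed

lemmas DERIV_partial1' [derivative_intros] = DERIV_chain2 [OF DERIV_partial1]

lemma DERIV_partial2:
  assumes "s > 0"
  shows "(partial2 has_real_derivative - s * deriv partial1 s) (at s)"
  unfolding partial2_def [abs_def] using assms by (auto intro!: derivative_eq_intros)

lemmas DERIV_partial2' [derivative_intros] = DERIV_chain2 [OF DERIV_partial2]

lemma D12_V_real:
  assumes "s > 0"
  shows "D12 (V_real H) (1 / s) 1 = - deriv partial1 s * s ^ 3"
  unfolding D12_def D1_def
proof (rule DERIV_imp_deriv)
  have "((\<lambda>x. partial1 (1 / x) / x - profile (1 / x))
      has_real_derivative - deriv partial1 s * s ^ 3) (at (1 / s))"
    using assms by (auto intro!: derivative_eq_intros simp: field_simps power2_eq_square power3_eq_cube)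
  then show "((\<lambda>x. D2 (V_real H) x 1)
      has_real_derivative - deriv partial1 s * s ^ 3) (at (1 / s))"
    by (rule has_field_derivative_transform_within_open [where S = "{0<..}"])
      (use assms in \<open>auto simp: D2_V_real\<close>)
qed

lemma continuous_deriv_partial1:
  assumes "continuous_on ({0<..} \<times> {0<..}) (\<lambda>(x, y). D12 (V_real H) x y)"
  shows "continuous_on {0<..} (deriv partial1)"
proof -
  have "continuous_on {0<..} (\<lambda>s :: real. (1 / s, 1 :: real))"
    by (intro continuous_intros) auto
  moreover have "(\<lambda>s :: real. (1 / s, 1 :: real)) ` {0<..} \<subseteq> {0<..} \<times> {0<..}"
    by auto
  ultimately have "continuous_on {0<..} (\<lambda>s. D12 (V_real H) (1 / s) 1)"
    using continuous_on_compose2 [OF assms, of "{0<..}" "\<lambda>s. (1 / s, 1)"] by simp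
  then have "continuous_on {0<..} (\<lambda>s. - D12 (V_real H) (1 / s) 1 / s ^ 3)"
    by (intro continuous_on_divide continuous_on_minus continuous_on_power continuous_on_id) auto
  moreover have "- D12 (V_real H) (1 / s) 1 / s ^ 3 = deriv partial1 s" if "s \<in> {0<..}" for s
    using that D12_V_real [of s] by simp
  ultimately show ?thesis
    by (rule continuous_on_eq)
qed

lemma profile_mono: "s \<le> s' \<Longrightarrow> profile s \<le> profile s'"
  unfolding profile_def by (rule tail_dep_mono [OF spectral]) auto

lemma profile_lipschitz: "s \<le> s' \<Longrightarrow> profile s' \<le> profile s + (s' - s)"
  using tail_dep_lipschitz [OF spectral, of s s' 1 1] by (simp add: profile_def)

lemma profile_ge:
  assumes "s \<ge> 0"
  shows "profile s \<ge> s" "profile s \<ge> 1"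
  using tail_dep_ge [OF spectral, of s 1] assms by (simp_all add: profile_def)

lemma profile_le: "s \<ge> 0 \<Longrightarrow> profile s \<le> 1 + s"
  using tail_dep_lipschitz [OF spectral, of 0 s 1 1] tail_dep_left_0 [OF spectral, of 1]
  by (simp add: profile_def)

lemma partial1_ge_0: "s > 0 \<Longrightarrow> partial1 s \<ge> 0"
  by (rule mono_on_imp_deriv_nonneg [of UNIV profile]) (auto intro: mono_onI profile_mono DERIV_profile)

lemma partial1_le_1:
  assumes "s > 0"
  shows "partial1 s \<le> 1"
proof -
  have "((\<lambda>s. s - profile s) has_real_derivative 1 - partial1 s) (at s)"
    using assms by (auto intro!: derivative_eq_intros)
  then have "1 - partial1 s \<ge> 0"
  proof (rule mono_on_imp_deriv_nonneg [rotated])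
    show "mono_on UNIV (\<lambda>s. s - profile s)"
    proof (rule mono_onI)
      fix s s' :: real assume "s \<le> s'"
      then show "s - profile s \<le> s' - profile s'"
        using profile_lipschitz [of s s'] by simp
    qed
  qed auto
  then show ?thesis by simp
qed

lemma DERIV_tail_dep_1:
  assumes "a > 0" "b > 0"
  shows "((\<lambda>a. tail_dep H a b) has_real_derivative partial1 (a / b)) (at a)"
  unfolding tail_dep_eq [OF assms(2)] using assms by (auto intro!: derivative_eq_intros)

lemma DERIV_tail_dep_2:
  assumes "a > 0" "b > 0"
  shows "(tail_dep H a has_real_derivative partial2 (a / b)) (at b)"
proof -
  have "((\<lambda>b. b * profile (a / b)) has_real_derivative partial2 (a / b)) (at b)"
    using assms by (auto intro!: derivative_eq_intros simp: partial2_def)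
  then show ?thesis
    by (rule has_field_derivative_transform_within_open [where S = "{0<..}"])
      (use assms in \<open>auto simp: tail_dep_eq\<close>)
qed

lemma partial2_ge_0:
  assumes "s > 0"
  shows "partial2 s \<ge> 0"
proof (rule mono_on_imp_deriv_nonneg [of UNIV "tail_dep H s"])
  show "mono_on UNIV (tail_dep H s)"
    by (auto intro: mono_onI tail_dep_mono [OF spectral])
  show "(tail_dep H s has_real_derivative partial2 s) (at 1)"
    using DERIV_tail_dep_2 [of s 1] assms by simp
qed auto

lemma partial2_le_1:
  assumes "s > 0"
  shows "partial2 s \<le> 1"
proof -
  have "((\<lambda>b. b - tail_dep H s b) has_real_derivative 1 - partial2 s) (at 1)"
    using assms DERIV_tail_dep_2 [of s 1] by (auto intro!: DERIV_diff)
  then have "1 - partial2 s \<ge> 0"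
  proof (rule mono_on_imp_deriv_nonneg [rotated])
    show "mono_on UNIV (\<lambda>b. b - tail_dep H s b)"
    proof (rule mono_onI)
      fix b b' :: real assume "b \<le> b'"
      then show "b - tail_dep H s b \<le> b' - tail_dep H s b'"
        using tail_dep_lipschitz [OF spectral, of s s b b'] by simp
    qed
  qed auto
  then show ?thesis by simp
qed

text \<open>A zero of a nonnegative differentiable function is an interior minimum. The same argument applies to
the second partial derivative, whose derivative is \<open>- s\<close> times that of the first.\<close>

lemma partial1_eq_0_imp_deriv_partial1_eq_0:
  assumes "s > 0" "partial1 s = 0"
  shows "deriv partial1 s = 0"
  by (rule DERIV_local_min [OF DERIV_partial1, where d = s]) (use assms partial1_ge_0 in auto)

lemma partial2_eq_0_imp_deriv_partial1_eq_0:
  assumes "s > 0" "partial2 s = 0"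
  shows "deriv partial1 s = 0"
proof -
  have "- s * deriv partial1 s = 0"
    by (rule DERIV_local_min [OF DERIV_partial2, where d = s]) (use assms partial2_ge_0 in auto)
  with assms show ?thesis by simp
qed

text \<open>If the derivative of the profile vanishes at \<open>s\<close>, the bound \<open>partial2 s \<le> 1\<close> reads \<open>profile s \<le> 1\<close>;
since 1 is also a lower bound and the profile is nondecreasing, it is constant to the left of \<open>s\<close>.\<close>

lemma partial1_eq_0_downward:
  assumes "s > 0" "partial1 s = 0" "0 < r" "r < s"
  shows "partial1 r = 0"
proof -
  have eq: "profile x = 1" if "0 < x" "x < s" for x
    using partial2_le_1 [of s] profile_ge(2) [of x] profile_mono [of x s] that assms
      by (auto simp: partial2_def)
  have "(profile has_real_derivative 0) (at r)"
    by (rule has_field_derivative_transform_within_open [where S = "{0<..<s}" and f = "\<lambda>_. 1"])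
      (use assms eq in auto)
  then show ?thesis by (metis DERIV_imp_deriv partial1_def)
qed

text \<open>Here \<open>profile s = s * partial1 s \<le> s\<close>, so the profile meets its lower bound \<open>s\<close>; being 1-Lipschitz,
it must then follow this bound to the right of \<open>s\<close>.\<close>

lemma partial2_eq_0_upward:
  assumes "s > 0" "partial2 s = 0" "s < r"
  shows "partial2 r = 0"
proof -
  have "profile s = s"
    using profile_ge(1) [of s] mult_left_le [OF partial1_le_1 [of s], of s]
      assms by (simp add: partial2_def)
  then have eq: "profile x = x" if "s < x" for x
    using profile_ge(1) [of x] profile_lipschitz [of s x] that assms by linarith
  have "(profile has_real_derivative 1) (at r)"
    by (rule has_field_derivative_transform_within_open [where S = "{s<..}" and f = "\<lambda>x. x"])
      (use assms eq in auto)
  then have "partial1 r = 1" by (metis DERIV_imp_deriv partial1_def)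
  then show ?thesis using eq assms by (simp add: partial2_def)
qed

text \<open>Where the profile touches one of its lower bounds, the difference has a minimum, which fixes the
derivative of the profile and makes one of the partial derivatives 0.\<close>

lemma profile_gt:
  assumes "s > 0"
  shows "partial1 s > 0 \<Longrightarrow> profile s > 1" "partial2 s > 0 \<Longrightarrow> profile s > s"
proof -
  show "profile s > 1" if "partial1 s > 0"
  proof (rule ccontr)
    assume "\<not> profile s > 1"
    then have "profile s = 1" using profile_ge(2) [of s] assms by simp
    have "partial1 s = 0"
      by (rule DERIV_local_min [OF DERIV_profile, where d = s])
        (use assms profile_ge(2) \<open>profile s = 1\<close> in auto)
    with that show False by simp
  qed
  show "profile s > s" if "partial2 s > 0"
  proof (rule ccontr)
    assume "\<not> profile s > s"
    then have "profile s = s" using profile_ge(1) [of s] assms by simp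
    have "((\<lambda>s. profile s - s) has_real_derivative partial1 s - 1) (at s)"
      using DERIV_diff [OF DERIV_profile [OF assms] DERIV_ident] .
    then have "partial1 s - 1 = 0"
      by (rule DERIV_local_min [where d = s]) (use assms profile_ge(1) \<open>profile s = s\<close> in auto)
    with that \<open>profile s = s\<close> show False by (simp add: partial2_def)
  qed
qed

section \<open>Derivatives of the inverted extreme value copula\<close>

text \<open>This is \<open>L\<^sub>1 * L\<^sub>2 - L\<^sub>1\<^sub>2\<close> for the tail dependence function \<open>L\<close>, the factor of the density next to the
exponential (see \<open>copula_density_exp_cdf\<close>).\<close>

definition density_factor :: "real \<Rightarrow> real \<Rightarrow> real" where
  "density_factor a b = partial1 (a / b) * partial2 (a / b) + a / b\<^sup>2 * deriv partial1 (a / b)"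

lemma copula_eq:
  assumes "0 < u" "u < 1" "0 < v" "v < 1"
  shows "inverted_EV_copula H u v = u + v - 1 + exp (- tail_dep H (- ln (1 - u)) (- ln (1 - v)))"
proof -
  have "ln (1 - u) < 0" "ln (1 - v) < 0" using assms by auto
  then show ?thesis
    using V_real_eq_tail_dep [of "- 1 / ln (1 - u)" "- 1 / ln (1 - v)" H]
    by (simp add: inverted_EV_copula_def divide_neg_neg)
qed

lemma D1_copula:
  assumes "0 < u" "u < 1" "0 < v" "v < 1"
  shows "D1 (inverted_EV_copula H) u v =
    1 - exp (- tail_dep H (- ln (1 - u)) (- ln (1 - v))) * partial1 (ln (1 - u) / ln (1 - v)) / (1 - u)"
  unfolding D1_def
proof (rule DERIV_imp_deriv)
  let ?b = "- ln (1 - v)"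
  have L: "((\<lambda>u. - ln (1 - u)) has_real_derivative 1 / (1 - u)) (at u)"
    using assms by (auto intro!: derivative_eq_intros simp: field_simps)
  have pos: "- ln (1 - u) > 0" "?b > 0" using assms by auto
  have "((\<lambda>u. tail_dep H (- ln (1 - u)) ?b) has_real_derivative
      partial1 (- ln (1 - u) / ?b) * (1 / (1 - u))) (at u)"
    by (rule DERIV_chain2 [where f = "\<lambda>a. tail_dep H a ?b", OF DERIV_tail_dep_1 [OF pos] L])
  then have "((\<lambda>u. u + v - 1 + exp (- tail_dep H (- ln (1 - u)) ?b)) has_real_derivative
      1 + exp (- tail_dep H (- ln (1 - u)) ?b)
        * - (partial1 (- ln (1 - u) / ?b) * (1 / (1 - u)))) (at u)"
    by (intro derivative_eq_intros) auto
  then have "((\<lambda>u. u + v - 1 + exp (- tail_dep H (- ln (1 - u)) ?b)) has_real_derivative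
      1 - exp (- tail_dep H (- ln (1 - u)) ?b) * partial1 (ln (1 - u) / ln (1 - v)) / (1 - u)) (at u)"
    by simp
  then show "((\<lambda>u. inverted_EV_copula H u v) has_real_derivative
      1 - exp (- tail_dep H (- ln (1 - u)) ?b) * partial1 (ln (1 - u) / ln (1 - v)) / (1 - u)) (at u)"
    by (rule has_field_derivative_transform_within_open [where S = "{0<..<1}"])
      (use assms in \<open>auto simp: copula_eq\<close>)
qed

lemma D2_copula:
  assumes "0 < u" "u < 1" "0 < v" "v < 1"
  shows "D2 (inverted_EV_copula H) u v =
    1 - exp (- tail_dep H (- ln (1 - u)) (- ln (1 - v))) * partial2 (ln (1 - u) / ln (1 - v)) / (1 - v)"
  unfolding D2_def
proof (rule DERIV_imp_deriv)
  let ?a = "- ln (1 - u)"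
  have L: "((\<lambda>v. - ln (1 - v)) has_real_derivative 1 / (1 - v)) (at v)"
    using assms by (auto intro!: derivative_eq_intros simp: field_simps)
  have pos: "?a > 0" "- ln (1 - v) > 0" using assms by auto
  have "((\<lambda>v. tail_dep H ?a (- ln (1 - v))) has_real_derivative
      partial2 (?a / - ln (1 - v)) * (1 / (1 - v))) (at v)"
    by (rule DERIV_chain2 [where f = "tail_dep H ?a", OF DERIV_tail_dep_2 [OF pos] L])
  then have "((\<lambda>v. u + v - 1 + exp (- tail_dep H ?a (- ln (1 - v)))) has_real_derivative
      1 + exp (- tail_dep H ?a (- ln (1 - v)))
        * - (partial2 (?a / - ln (1 - v)) * (1 / (1 - v)))) (at v)"
    by (intro derivative_eq_intros) auto
  then have "((\<lambda>v. u + v - 1 + exp (- tail_dep H ?a (- ln (1 - v)))) has_real_derivative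
      1 - exp (- tail_dep H ?a (- ln (1 - v))) * partial2 (ln (1 - u) / ln (1 - v)) / (1 - v)) (at v)"
    by simp
  then show "(inverted_EV_copula H u has_real_derivative
      1 - exp (- tail_dep H ?a (- ln (1 - v))) * partial2 (ln (1 - u) / ln (1 - v)) / (1 - v)) (at v)"
    by (rule has_field_derivative_transform_within_open [where S = "{0<..<1}"])
      (use assms in \<open>auto simp: copula_eq\<close>)
qed

lemma copula_density:
  assumes "0 < u" "u < 1" "0 < v" "v < 1"
  shows "inverted_EV_copula_density H u v =
    exp (- tail_dep H (- ln (1 - u)) (- ln (1 - v))) * density_factor (- ln (1 - u)) (- ln (1 - v))
      / ((1 - u) * (1 - v))"
  unfolding inverted_EV_copula_density_def D12_def D1_def
proof (rule DERIV_imp_deriv)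
  define a where "a = - ln (1 - u)"
  define b where "b = - ln (1 - v)"
  have pos: "a > 0" "b > 0" using assms by (auto simp: a_def b_def)
  have L: "((\<lambda>u. - ln (1 - u)) has_real_derivative 1 / (1 - u)) (at u)"
    using assms by (auto intro!: derivative_eq_intros simp: field_simps)
  have "((\<lambda>a. 1 - exp (- tail_dep H a b) * partial2 (a / b) / c) has_real_derivative
      exp (- tail_dep H a b) * density_factor a b / c) (at a)" if "c > 0" for c
    using pos that
    by (auto intro!: derivative_eq_intros DERIV_tail_dep_1
      simp: density_factor_def field_simps power2_eq_square)
  then have "((\<lambda>a. 1 - exp (- tail_dep H a b) * partial2 (a / b) / (1 - v)) has_real_derivative
      exp (- tail_dep H a b) * density_factor a b / (1 - v)) (at a)"
    using assms by simp
  then have "((\<lambda>u. 1 - exp (- tail_dep H (- ln (1 - u)) b) * partial2 (- ln (1 - u) / b) / (1 - v))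
      has_real_derivative exp (- tail_dep H a b) * density_factor a b / (1 - v) * (1 / (1 - u))) (at u)"
    unfolding a_def
    by (rule DERIV_chain2 [where g = "\<lambda>u. - ln (1 - u)" and x = u, OF _ L])
  then have "((\<lambda>u. 1 - exp (- tail_dep H (- ln (1 - u)) b) * partial2 (- ln (1 - u) / b) / (1 - v))
      has_real_derivative exp (- tail_dep H a b) * density_factor a b / ((1 - u) * (1 - v))) (at u)"
    by (simp add: mult.commute)
  then show "((\<lambda>u. D2 (inverted_EV_copula H) u v) has_real_derivative
      exp (- tail_dep H a b) * density_factor a b / ((1 - u) * (1 - v))) (at u)"
    by (rule has_field_derivative_transform_within_open [where S = "{0<..<1}"])
      (use assms in \<open>auto simp: D2_copula b_def\<close>)
qed

lemma exp_cdf_bounds: "a > 0 \<Longrightarrow> 0 < exp_cdf a" "exp_cdf a < 1"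
  by (simp_all add: exp_cdf_def)

lemma one_minus_exp_cdf: "1 - exp_cdf a = exp (- a)"
  by (simp add: exp_cdf_def)

lemma copula_density_exp_cdf:
  assumes "a > 0" "b > 0"
  shows "inverted_EV_copula_density H (exp_cdf a) (exp_cdf b) = exp (a + b - tail_dep H a b)
      * density_factor a b"
  using assms exp_cdf_bounds [of a] exp_cdf_bounds [of b]
  by (simp add: copula_density one_minus_exp_cdf)
    (simp add: exp_diff exp_add exp_minus field_simps)

text \<open>On the exponential scale, conditioning subtracts the coordinate conditioned on and adds a
correction that is constant along rays.\<close>

lemma cond_cdf_1_given_2_eq:
  assumes "a > 0" "b > 0" "partial2 (a / b) > 0"
  shows "cond_cdf_1_given_2 H a b = exp_cdf (tail_dep H a b - b - ln (partial2 (a / b)))"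
  using assms exp_cdf_bounds [of a] exp_cdf_bounds [of b]
  by (simp add: cond_cdf_1_given_2_def D2_copula one_minus_exp_cdf)
    (simp add: exp_cdf_def exp_diff exp_add exp_minus field_simps)

lemma cond_cdf_3_given_2_eq:
  assumes "a > 0" "b > 0" "partial1 (a / b) > 0"
  shows "cond_cdf_3_given_2 H b a = exp_cdf (tail_dep H a b - a - ln (partial1 (a / b)))"
  using assms exp_cdf_bounds [of a] exp_cdf_bounds [of b]
  by (simp add: cond_cdf_3_given_2_def D1_copula one_minus_exp_cdf)
    (simp add: exp_cdf_def exp_diff exp_add exp_minus field_simps)

text \<open>A vanishing partial derivative takes the mixed derivative with it, hence the whole factor.\<close>

lemma density_factor_nonzero_imp:
  assumes "a > 0" "b > 0" "density_factor a b \<noteq> 0"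
  shows "partial1 (a / b) > 0" "partial2 (a / b) > 0"
proof -
  have s: "a / b > 0" using assms by simp
  have "partial1 (a / b) \<noteq> 0"
    using assms partial1_eq_0_imp_deriv_partial1_eq_0 [OF s] by (auto simp: density_factor_def)
  then show "partial1 (a / b) > 0" using partial1_ge_0 [OF s] by simp
  have "partial2 (a / b) \<noteq> 0"
    using assms partial2_eq_0_imp_deriv_partial1_eq_0 [OF s] by (auto simp: density_factor_def)
  then show "partial2 (a / b) > 0" using partial2_ge_0 [OF s] by simp
qed

lemma tail_dep_gt:
  assumes "a > 0" "b > 0"
  shows "partial1 (a / b) > 0 \<Longrightarrow> tail_dep H a b > b" "partial2 (a / b) > 0 \<Longrightarrow> tail_dep H a b > a"
  using profile_gt [of "a / b"] assms by (simp_all add: tail_dep_eq field_simps)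

text \<open>Near the axis \<open>a = 0\<close> the second partial derivative tends to 1, and likewise the first one near
\<open>b = 0\<close>. This keeps the logarithmic corrections small when a coordinate tends to 0.\<close>

lemma partial2_ge:
  assumes "s > 0"
  shows "partial2 s \<ge> 1 - s"
proof -
  have "s * partial1 s \<le> s"
    using mult_left_le [OF partial1_le_1 [OF assms], of s] assms by simp
  then show ?thesis
    using profile_ge(2) [of s] assms unfolding partial2_def by linarith
qed

lemma partial1_ge:
  assumes "s > 0"
  shows "partial1 s \<ge> 1 - 1 / s"
  using profile_ge(1) [of s] partial2_le_1 [of s] assms by (simp add: partial2_def field_simps)

lemma continuous_partial1: "continuous_on {0<..} partial1"
  using DERIV_partial1 by (intro continuous_at_imp_continuous_on ballI DERIV_isCont) auto

lemma continuous_partial2: "continuous_on {0<..} partial2"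
  using DERIV_partial2 by (intro continuous_at_imp_continuous_on ballI DERIV_isCont) auto

text \<open>Along a ray the ratio \<open>a / b\<close> is constant and the mixed derivative decays like \<open>1 / t\<close>.\<close>

lemma density_factor_along_ray:
  assumes "a > 0" "b > 0"
  shows "((\<lambda>t. density_factor (t * a) (t * b)) \<longlongrightarrow> partial1 (a / b) * partial2 (a / b)) at_top"
proof -
  have "((\<lambda>t. partial1 (a / b) * partial2 (a / b) + (a / b\<^sup>2 * deriv partial1 (a / b)) * inverse t) \<longlongrightarrow>
      partial1 (a / b) * partial2 (a / b) + (a / b\<^sup>2 * deriv partial1 (a / b)) * 0) at_top"
    by (intro tendsto_intros tendsto_inverse_0_at_top filterlim_ident)
  moreover have "\<forall>\<^sub>F t in at_top. partial1 (a / b) * partial2 (a / b) + (a / b\<^sup>2 * deriv partial1 (a / b)) * inverse t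
      = density_factor (t * a) (t * b)"
    using eventually_gt_at_top [of 0]
    by eventually_elim (simp add: density_factor_def power2_eq_square field_simps)
  ultimately show ?thesis
    by (auto elim: Lim_transform_eventually)
qed

text \<open>When a ray is followed only asymptotically, the ratio of the coordinates varies, and continuity of
the mixed derivative is what bounds its contribution.\<close>

lemma density_factor_asymptotic:
  assumes "continuous_on {0<..} (deriv partial1)" "a > 0" "b > 0"
    and A: "((\<lambda>t. A t / t) \<longlongrightarrow> a) at_top" and B: "((\<lambda>t. B t / t) \<longlongrightarrow> b) at_top"
  shows "((\<lambda>t. density_factor (A t) (B t)) \<longlongrightarrow> partial1 (a / b) * partial2 (a / b)) at_top"
proof -
  let ?s = "\<lambda>t. (A t / t) / (B t / t)"
  have s: "(?s \<longlongrightarrow> a / b) at_top"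
    using assms by (intro tendsto_divide) auto
  have lim: "((\<lambda>t. f (?s t)) \<longlongrightarrow> f (a / b)) at_top"
    if "continuous_on {0<..} f" for f :: "real \<Rightarrow> real"
  proof (rule isCont_tendsto_compose [OF _ s])
    show "isCont f (a / b)"
      using that assms by (simp add: continuous_on_eq_continuous_at)
  qed
  have "((\<lambda>t. partial1 (?s t) * partial2 (?s t) + ?s t / (B t / t) * deriv partial1 (?s t) * inverse t) \<longlongrightarrow>
      partial1 (a / b) * partial2 (a / b) + (a / b) / b * deriv partial1 (a / b) * 0) at_top"
    using assms
    by (intro tendsto_intros tendsto_inverse_0_at_top filterlim_ident lim s
        continuous_partial1 continuous_partial2) auto
  moreover have "\<forall>\<^sub>F t in at_top.
      partial1 (?s t) * partial2 (?s t) + ?s t / (B t / t) * deriv partial1 (?s t) * inverse t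
        = density_factor (A t) (B t)"
    using eventually_gt_at_top [of 0]
    by eventually_elim (simp add: density_factor_def power2_eq_square)
  ultimately show ?thesis
    by (auto elim: Lim_transform_eventually)
qed

end

section \<open>The trivariate vine density\<close>

locale vine =
  V12: smooth_spectral H12 + V23: smooth_spectral H23 + V13: smooth_spectral H13
  for H12 H23 H13 :: "real measure" +
  assumes density_pos:
    "x1 > 0 \<Longrightarrow> x2 > 0 \<Longrightarrow> x3 > 0 \<Longrightarrow> vine_density H12 H23 H13 (x1, x2, x3) > 0"
begin

text \<open>The conditional distribution functions, transformed to the exponential scale: these are the
coordinates at which the density of the conditional pair is evaluated.\<close>

definition score1 :: "real \<Rightarrow> real \<Rightarrow> real" where
  "score1 x1 x2 = tail_dep H12 x1 x2 - x2 - ln (V12.partial2 (x1 / x2))"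

definition score3 :: "real \<Rightarrow> real \<Rightarrow> real" where
  "score3 x2 x3 = tail_dep H23 x2 x3 - x2 - ln (V23.partial1 (x2 / x3))"

definition gauge :: "real \<times> real \<times> real \<Rightarrow> real" where
  "gauge = (\<lambda>(x1, x2, x3). x2 + tail_dep H13 (tail_dep H12 x1 x2 - x2) (tail_dep H23 x2 x3 - x2))"

lemma pair_densities_nonzero:
  assumes "x1 > 0" "x2 > 0" "x3 > 0"
  shows "V12.density_factor x1 x2 \<noteq> 0" "V23.density_factor x2 x3 \<noteq> 0"
    "inverted_EV_copula_density H13 (cond_cdf_1_given_2 H12 x1 x2) (cond_cdf_3_given_2 H23 x3 x2) \<noteq> 0"
  using density_pos [OF assms] assms
  by (auto simp: vine_density_def pos_orthant_def V12.copula_density_exp_cdf V23.copula_density_exp_cdf)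

lemma pair_partials_pos:
  assumes "s > 0"
  shows "V12.partial1 s > 0" "V12.partial2 s > 0" "V23.partial1 s > 0" "V23.partial2 s > 0"
  using V12.density_factor_nonzero_imp [of s 1] V23.density_factor_nonzero_imp [of s 1] assms
    pair_densities_nonzero [of s 1 1] pair_densities_nonzero [of 1 s 1] by simp_all

lemma score1_pos:
  assumes "x1 > 0" "x2 > 0"
  shows "score1 x1 x2 > 0"
proof -
  have s: "x1 / x2 > 0" using assms by simp
  have "ln (V12.partial2 (x1 / x2)) \<le> 0"
    using V12.partial2_le_1 [OF s] pair_partials_pos [OF s] by (simp add: ln_le_zero_iff)
  then show ?thesis
    using V12.tail_dep_gt(1) [OF assms pair_partials_pos(1) [OF s]] unfolding score1_def by linarith
qed

lemma score3_pos:
  assumes "x2 > 0" "x3 > 0"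
  shows "score3 x2 x3 > 0"
proof -
  have s: "x2 / x3 > 0" using assms by simp
  have "ln (V23.partial1 (x2 / x3)) \<le> 0"
    using V23.partial1_le_1 [OF s] pair_partials_pos [OF s] by (simp add: ln_le_zero_iff)
  then show ?thesis
    using V23.tail_dep_gt(2) [OF assms pair_partials_pos(4) [OF s]] unfolding score3_def by linarith
qed

lemma cond_density_eq:
  assumes "x1 > 0" "x2 > 0" "x3 > 0"
  shows "inverted_EV_copula_density H13 (cond_cdf_1_given_2 H12 x1 x2) (cond_cdf_3_given_2 H23 x3 x2)
    = exp (score1 x1 x2 + score3 x2 x3 - tail_dep H13 (score1 x1 x2) (score3 x2 x3))
        * V13.density_factor (score1 x1 x2) (score3 x2 x3)"
  using assms pair_partials_pos
  by (simp add: V12.cond_cdf_1_given_2_eq V23.cond_cdf_3_given_2_eq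
      V13.copula_density_exp_cdf score1_pos score3_pos flip: score1_def score3_def)

lemma cond_partials_pos_at_scores:
  assumes "x1 > 0" "x2 > 0" "x3 > 0"
  shows "V13.partial1 (score1 x1 x2 / score3 x2 x3) > 0"
    "V13.partial2 (score1 x1 x2 / score3 x2 x3) > 0"
proof -
  have "V13.density_factor (score1 x1 x2) (score3 x2 x3) \<noteq> 0"
    using pair_densities_nonzero(3) [OF assms] cond_density_eq [OF assms] by simp
  then show "V13.partial1 (score1 x1 x2 / score3 x2 x3) > 0"
    "V13.partial2 (score1 x1 x2 / score3 x2 x3) > 0"
    using V13.density_factor_nonzero_imp [OF score1_pos score3_pos] assms by simp_all
qed

text \<open>As the outer coordinate tends to 0 the score tends to 0, which lets the scores come arbitrarily close
to both axes in direction.\<close>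

lemma score1_le:
  assumes "0 < x" "x < 1"
  shows "score1 x 1 \<le> x - ln (1 - x)"
proof -
  have "ln (1 - x) \<le> ln (V12.partial2 x)"
    using V12.partial2_ge [of x] assms by simp
  moreover have "tail_dep H12 x 1 \<le> 1 + x"
    using V12.profile_le [of x] assms by (simp add: V12.profile_def)
  ultimately show ?thesis by (simp add: score1_def)
qed

lemma score3_le:
  assumes "0 < x" "x < 1"
  shows "score3 1 x \<le> x - ln (1 - x)"
proof -
  have "ln (1 - x) \<le> ln (V23.partial1 (1 / x))"
    using V23.partial1_ge [of "1 / x"] assms by simp
  moreover have "tail_dep H23 1 x \<le> 1 + x"
    using tail_dep_lipschitz [OF V23.spectral, of 1 1 0 x] tail_dep_right_0 [OF V23.spectral, of 1]
      assms by simp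
  ultimately show ?thesis by (simp add: score3_def)
qed

lemma small_bound:
  assumes "\<epsilon> > 0"
  obtains x :: real where "0 < x" "x < 1" "x - ln (1 - x) < \<epsilon>"
proof -
  have "((\<lambda>x :: real. x - ln (1 - x)) \<longlongrightarrow> 0 - ln (1 - 0)) (at_right 0)"
    by (intro tendsto_intros) auto
  then have "\<forall>\<^sub>F x in at_right (0 :: real). x - ln (1 - x) < \<epsilon>"
    using assms by (intro order_tendstoD) auto
  moreover have "\<forall>\<^sub>F x in at_right (0 :: real). x \<in> {0<..<1}"
    by (rule eventually_at_right_real) simp
  ultimately have "\<forall>\<^sub>F x in at_right (0 :: real). x - ln (1 - x) < \<epsilon> \<and> x \<in> {0<..<1}"
    by (rule eventually_conj)
  then obtain x :: real where "x - ln (1 - x) < \<epsilon> \<and> x \<in> {0<..<1}"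
    using eventually_happens' [OF trivial_limit_at_right_real] by blast
  then show ?thesis using that by auto
qed

text \<open>Letting \<open>x1\<close> tend to 0 produces scores with an arbitrarily small ratio. A zero at \<open>s\<close> would extend
down to such a ratio, where positivity of the density excludes it.\<close>

lemma cond_partial1_pos:
  assumes "s > 0"
  shows "V13.partial1 s > 0"
proof (rule ccontr)
  assume "\<not> V13.partial1 s > 0"
  then have zero: "V13.partial1 s = 0" using V13.partial1_ge_0 [OF assms] by simp
  have "score3 1 1 > 0" by (simp add: score3_pos)
  then have "s * score3 1 1 > 0" using assms by simp
  from small_bound [OF this]
  obtain x where x: "0 < x" "x < 1" "x - ln (1 - x) < s * score3 1 1" .
  have "score1 x 1 / score3 1 1 < s"
    using score1_le [OF x(1,2)] x(3) \<open>score3 1 1 > 0\<close> by (simp add: pos_divide_less_eq)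
  moreover have "score1 x 1 / score3 1 1 > 0"
    using score1_pos [of x 1] x \<open>score3 1 1 > 0\<close> by simp
  ultimately have "V13.partial1 (score1 x 1 / score3 1 1) = 0"
    using V13.partial1_eq_0_downward [OF assms zero] by simp
  then show False using cond_partials_pos_at_scores(1) [of x 1 1] x by simp
qed

text \<open>The mirror image of the preceding argument, with \<open>x3\<close> tending to 0 and ratios above \<open>s\<close>.\<close>

lemma cond_partial2_pos:
  assumes "s > 0"
  shows "V13.partial2 s > 0"
proof (rule ccontr)
  assume "\<not> V13.partial2 s > 0"
  then have zero: "V13.partial2 s = 0" using V13.partial2_ge_0 [OF assms] by simp
  have "score1 1 1 > 0" by (simp add: score1_pos)
  then have "score1 1 1 / s > 0" using assms by simp
  from small_bound [OF this]
  obtain x where x: "0 < x" "x < 1" "x - ln (1 - x) < score1 1 1 / s" .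
  have "score3 1 x > 0" using score3_pos [of 1 x] x by simp
  moreover have "score3 1 x < score1 1 1 / s"
    using score3_le [OF x(1,2)] x(3) by simp
  ultimately have "s < score1 1 1 / score3 1 x"
    using assms by (simp add: field_simps)
  then have "V13.partial2 (score1 1 1 / score3 1 x) = 0"
    using V13.partial2_eq_0_upward [OF assms zero] by simp
  then show False using cond_partials_pos_at_scores(2) [of 1 1 x] x by simp
qed

text \<open>The terms \<open>- score1\<close> and \<open>- score3\<close> of the conditional density cancel the tail dependence functions of
the two pairs, which leaves one copy of \<open>x2\<close> and the logarithmic corrections.\<close>

lemma ln_vine_density:
  assumes "x1 > 0" "x2 > 0" "x3 > 0"
    and "V12.density_factor x1 x2 > 0" "V23.density_factor x2 x3 > 0"
      "V13.density_factor (score1 x1 x2) (score3 x2 x3) > 0"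
  shows "- ln (vine_density H12 H23 H13 (x1, x2, x3)) =
    x2 + tail_dep H13 (score1 x1 x2) (score3 x2 x3) + ln (V12.partial2 (x1 / x2)) + ln (V23.partial1 (x2 / x3))
      - ln (V12.density_factor x1 x2) - ln (V23.density_factor x2 x3)
        - ln (V13.density_factor (score1 x1 x2) (score3 x2 x3))"
proof -
  have "vine_density H12 H23 H13 (x1, x2, x3) =
      exp (- x1) * exp (- x2) * exp (- x3) * (exp (x1 + x2 - tail_dep H12 x1 x2) * V12.density_factor x1 x2)
      * (exp (x2 + x3 - tail_dep H23 x2 x3) * V23.density_factor x2 x3)
      * (exp (score1 x1 x2 + score3 x2 x3 - tail_dep H13 (score1 x1 x2) (score3 x2 x3))
        * V13.density_factor (score1 x1 x2) (score3 x2 x3))"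
    using assms cond_density_eq [OF assms(1-3)]
    by (simp add: vine_density_def pos_orthant_def exp_pdf_def
        V12.copula_density_exp_cdf V23.copula_density_exp_cdf)
  then show ?thesis
    using assms by (simp add: ln_mult score1_def score3_def)
qed

lemma score1_asymptotic:
  "((\<lambda>t. score1 (t * x1) (t * x2) / t) \<longlongrightarrow> tail_dep H12 x1 x2 - x2) at_top"
proof -
  have "((\<lambda>t. tail_dep H12 x1 x2 - x2 - ln (V12.partial2 (x1 / x2)) * inverse t) \<longlongrightarrow>
      tail_dep H12 x1 x2 - x2 - ln (V12.partial2 (x1 / x2)) * 0) at_top"
    by (intro tendsto_intros tendsto_inverse_0_at_top filterlim_ident)
  moreover have "\<forall>\<^sub>F t in at_top. tail_dep H12 x1 x2 - x2 - ln (V12.partial2 (x1 / x2)) * inverse t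
      = score1 (t * x1) (t * x2) / t"
    using eventually_gt_at_top [of 0]
    by eventually_elim (simp add: score1_def tail_dep_homogeneous field_simps)
  ultimately show ?thesis
    by (simp add: Lim_transform_eventually)
qed

lemma score3_asymptotic:
  "((\<lambda>t. score3 (t * x2) (t * x3) / t) \<longlongrightarrow> tail_dep H23 x2 x3 - x2) at_top"
proof -
  have "((\<lambda>t. tail_dep H23 x2 x3 - x2 - ln (V23.partial1 (x2 / x3)) * inverse t) \<longlongrightarrow>
      tail_dep H23 x2 x3 - x2 - ln (V23.partial1 (x2 / x3)) * 0) at_top"
    by (intro tendsto_intros tendsto_inverse_0_at_top filterlim_ident)
  moreover have "\<forall>\<^sub>F t in at_top. tail_dep H23 x2 x3 - x2 - ln (V23.partial1 (x2 / x3)) * inverse t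
      = score3 (t * x2) (t * x3) / t"
    using eventually_gt_at_top [of 0]
    by eventually_elim (simp add: score3_def tail_dep_homogeneous field_simps)
  ultimately show ?thesis
    by (simp add: Lim_transform_eventually)
qed

lemma tendsto_ln_times_inverse:
  assumes "(h \<longlongrightarrow> c) at_top" "(c :: real) > 0"
  shows "((\<lambda>t :: real. ln (h t) * inverse t) \<longlongrightarrow> 0) at_top"
proof -
  have "((\<lambda>t :: real. ln (h t) * inverse t) \<longlongrightarrow> ln c * 0) at_top"
    using assms by (intro tendsto_intros tendsto_inverse_0_at_top filterlim_ident) auto
  then show ?thesis by simp
qed

lemma vine_asymptotic:
  assumes cont: "continuous_on ({0<..} \<times> {0<..}) (\<lambda>(x, y). D12 (V_real H13) x y)"
    and pos: "x1 > 0" "x2 > 0" "x3 > 0"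
  shows "((\<lambda>t. - ln (vine_density H12 H23 H13 (t * x1, t * x2, t * x3)) / t)
    \<longlongrightarrow> gauge (x1, x2, x3)) at_top"
proof -
  define a where "a = tail_dep H12 x1 x2 - x2"
  define b where "b = tail_dep H23 x2 x3 - x2"
  let ?A = "\<lambda>t. score1 (t * x1) (t * x2)" and ?B = "\<lambda>t. score3 (t * x2) (t * x3)"
  let ?s = "x1 / x2" and ?r = "x2 / x3"
  have s: "?s > 0" "?r > 0" using pos by auto
  have ab: "a > 0" "b > 0"
    using V12.tail_dep_gt(1) [of x1 x2] V23.tail_dep_gt(2) [of x2 x3] pos pair_partials_pos s
    by (auto simp: a_def b_def)
  have A: "((\<lambda>t. ?A t / t) \<longlongrightarrow> a) at_top" and B: "((\<lambda>t. ?B t / t) \<longlongrightarrow> b) at_top"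
    unfolding a_def b_def by (rule score1_asymptotic score3_asymptotic)+
  have W12: "((\<lambda>t. V12.density_factor (t * x1) (t * x2)) \<longlongrightarrow> V12.partial1 ?s * V12.partial2 ?s) at_top"
    and W23: "((\<lambda>t. V23.density_factor (t * x2) (t * x3)) \<longlongrightarrow> V23.partial1 ?r * V23.partial2 ?r) at_top"
    using pos by (intro V12.density_factor_along_ray V23.density_factor_along_ray; simp)+
  have W13: "((\<lambda>t. V13.density_factor (?A t) (?B t)) \<longlongrightarrow> V13.partial1 (a / b) * V13.partial2 (a / b)) at_top"
    by (rule V13.density_factor_asymptotic [OF V13.continuous_deriv_partial1 [OF cont] ab A B])
  have lims_pos: "V12.partial1 ?s * V12.partial2 ?s > 0" "V23.partial1 ?r * V23.partial2 ?r > 0"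
    "V13.partial1 (a / b) * V13.partial2 (a / b) > 0"
    using pair_partials_pos s cond_partial1_pos cond_partial2_pos ab by simp_all
  have ev: "\<forall>\<^sub>F t in at_top. V12.density_factor (t * x1) (t * x2) > 0"
    "\<forall>\<^sub>F t in at_top. V23.density_factor (t * x2) (t * x3) > 0"
    "\<forall>\<^sub>F t in at_top. V13.density_factor (?A t) (?B t) > 0"
    using order_tendstoD(1) [OF W12 lims_pos(1)] order_tendstoD(1) [OF W23 lims_pos(2)]
      order_tendstoD(1) [OF W13 lims_pos(3)] by auto
  have "((\<lambda>t. tail_dep H13 (?A t / t) (?B t / t)) \<longlongrightarrow> tail_dep H13 a b) at_top"
    using continuous_on_tendsto_compose
      [OF continuous_tail_dep [OF V13.spectral] tendsto_Pair [OF A B]] by simp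
  then have "((\<lambda>t. x2 + tail_dep H13 (?A t / t) (?B t / t)
        + (ln (V12.partial2 ?s) + ln (V23.partial1 ?r)) * inverse t
        - ln (V12.density_factor (t * x1) (t * x2)) * inverse t
        - ln (V23.density_factor (t * x2) (t * x3)) * inverse t
        - ln (V13.density_factor (?A t) (?B t)) * inverse t)
      \<longlongrightarrow> x2 + tail_dep H13 a b + (ln (V12.partial2 ?s) + ln (V23.partial1 ?r)) * 0 - 0 - 0 - 0) at_top"
    by (intro tendsto_add tendsto_diff tendsto_mult tendsto_const tendsto_inverse_0_at_top
        filterlim_ident tendsto_ln_times_inverse [OF W12]
        tendsto_ln_times_inverse [OF W23] tendsto_ln_times_inverse [OF W13] lims_pos)
  moreover have "\<forall>\<^sub>F t in at_top. x2 + tail_dep H13 (?A t / t) (?B t / t)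
        + (ln (V12.partial2 ?s) + ln (V23.partial1 ?r)) * inverse t
        - ln (V12.density_factor (t * x1) (t * x2)) * inverse t
        - ln (V23.density_factor (t * x2) (t * x3)) * inverse t
        - ln (V13.density_factor (?A t) (?B t)) * inverse t
      = - ln (vine_density H12 H23 H13 (t * x1, t * x2, t * x3)) / t"
    using ev eventually_gt_at_top [of 0]
  proof eventually_elim
    case (elim t)
    have hom: "tail_dep H13 (?A t / t) (?B t / t) = tail_dep H13 (?A t) (?B t) / t"
      using tail_dep_homogeneous [of t H13 "?A t / t" "?B t / t"] elim by simp
    have ln_eq: "- ln (vine_density H12 H23 H13 (t * x1, t * x2, t * x3)) =
      t * x2 + tail_dep H13 (?A t) (?B t) + ln (V12.partial2 ?s) + ln (V23.partial1 ?r)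
      - ln (V12.density_factor (t * x1) (t * x2)) - ln (V23.density_factor (t * x2) (t * x3))
        - ln (V13.density_factor (?A t) (?B t))"
      using ln_vine_density [of "t * x1" "t * x2" "t * x3"] elim pos by simp
    show ?case
      unfolding hom ln_eq using elim
      by (simp add: add_divide_distrib diff_divide_distrib distrib_right flip: divide_inverse)
  qed
  ultimately show ?thesis
    by (simp add: Lim_transform_eventually gauge_def flip: a_def b_def)
qed

lemma gauge_continuous: "continuous_on UNIV gauge"
proof -
  have c: "continuous_on UNIV (\<lambda>x. tail_dep H (f x) (g x))"
    if "spectral_distribution H" "continuous_on UNIV f" "continuous_on UNIV g"
    for H and f g :: "real \<times> real \<times> real \<Rightarrow> real"
    using continuous_on_compose2
      [OF continuous_tail_dep [OF that(1)] continuous_on_Pair [OF that(2,3)]] by simp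
  show ?thesis
    unfolding gauge_def case_prod_beta
    by (intro continuous_on_add continuous_on_diff c V12.spectral V23.spectral V13.spectral
        continuous_on_fst continuous_on_snd continuous_on_id)
qed

lemma gauge_homogeneous:
  assumes "c > 0"
  shows "gauge (c *\<^sub>R x) = c * gauge x"
proof -
  have "c * a - c * b = c * (a - b)" for a b :: real
    by (simp add: right_diff_distrib)
  with assms show ?thesis
    by (cases x) (simp add: gauge_def tail_dep_homogeneous distrib_left)
qed

lemma gauge_vine_density:
  assumes "continuous_on ({0<..} \<times> {0<..}) (\<lambda>(x, y). D12 (V_real H13) x y)"
  shows "is_gauge_function (vine_density H12 H23 H13) gauge"
  unfolding is_gauge_function_def
proof (intro conjI allI impI ballI)
  show "continuous_on nonneg_orthant gauge"
    using gauge_continuous continuous_on_subset by blast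
  fix x assume "x \<in> pos_orthant"
  then obtain x1 x2 x3 where x: "x = (x1, x2, x3)" and pos: "x1 > 0" "x2 > 0" "x3 > 0"
    by (cases x) (auto simp: pos_orthant_def)
  have "tail_dep H13 0 0 \<le> tail_dep H13 (tail_dep H12 x1 x2 - x2) (tail_dep H23 x2 x3 - x2)"
    using tail_dep_ge(2) [OF V12.spectral, of x1 x2] tail_dep_ge(1) [OF V23.spectral, of x2 x3] pos
    by (intro tail_dep_mono [OF V13.spectral]) auto
  \<comment> \<open>Asymptotic equivalence follows from convergence of the quotient because the limit is not 0.\<close>
  then have "gauge x > 0"
    using pos by (simp add: x gauge_def tail_dep_def)
  have "((\<lambda>t. - ln (vine_density H12 H23 H13 (t *\<^sub>R x)) / t) \<longlongrightarrow> gauge x) at_top"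
    using vine_asymptotic [OF assms pos] by (simp add: x)
  from asymp_equivI'_const [OF this] \<open>gauge x > 0\<close>
  show "(\<lambda>t. - ln (vine_density H12 H23 H13 (t *\<^sub>R x))) \<sim>[at_top] (\<lambda>t. t * gauge x)"
    by (simp add: mult.commute)
qed (rule gauge_homogeneous)

end

section \<open>The gauge function\<close>

theorem mainTheorem2:
  fixes H12 H23 H13_2 :: "real measure"
    and M :: "'a measure"
    and X1 X2 X3 :: "'a \<Rightarrow> real"
    and f :: "real \<times> real \<times> real \<Rightarrow> real"
  assumes "spectral_distribution H12" "spectral_distribution H23" "spectral_distribution H13_2"
    and "V_derivatives_exist H12" "V_derivatives_exist H23" "V_derivatives_exist H13_2"
    and V12_cont: "continuous_on ({0<..} \<times> {0<..}) (\<lambda>(x, y). D12 (V_real H13_2) x y)"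
    and f_vine: "f = vine_density H12 H23 H13_2"
    and f_pos: "\<And>x. x \<in> pos_orthant \<Longrightarrow> f x > 0"
    and "prob_space M"
    and "distributed M lborel X1 (exponential_density 1)"
    and "distributed M lborel X2 (exponential_density 1)"
    and "distributed M lborel X3 (exponential_density 1)"
    and "distributed M lborel (\<lambda>\<omega>. (X1 \<omega>, X2 \<omega>, X3 \<omega>)) f"
  shows "is_gauge_function f (\<lambda>(x1, x2, x3).
      x2 + exponent_measure H13_2
             (inverse (ereal (exponent_measure H12 (inverse (ereal x1)) (inverse (ereal x2)) - x2)))
             (inverse (ereal (exponent_measure H23 (inverse (ereal x2)) (inverse (ereal x3)) - x2))))"
proof -
  let ?g = "\<lambda>(x1, x2, x3).
      x2 + exponent_measure H13_2
             (inverse (ereal (exponent_measure H12 (inverse (ereal x1)) (inverse (ereal x2)) - x2)))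
             (inverse (ereal (exponent_measure H23 (inverse (ereal x2)) (inverse (ereal x3)) - x2)))"
  interpret vine H12 H23 H13_2
    by unfold_locales
      (use assms(1-6) f_pos in \<open>auto simp: f_vine pos_orthant_def\<close>)
  have eq: "?g x = gauge x" if "x \<in> nonneg_orthant" for x
  proof -
    obtain x1 x2 x3 where x: "x = (x1, x2, x3)" and nonneg: "x1 \<ge> 0" "x2 \<ge> 0" "x3 \<ge> 0"
      using \<open>x \<in> nonneg_orthant\<close> by (cases x) (auto simp: nonneg_orthant_def)
    have "tail_dep H12 x1 x2 - x2 \<ge> 0" "tail_dep H23 x2 x3 - x2 \<ge> 0"
      using tail_dep_ge V12.spectral V23.spectral nonneg by auto
    then show ?thesis
      using nonneg by (simp only: x prod.case gauge_def exponent_measure_inverse)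
  qed
  have *: "is_gauge_function f gauge"
    unfolding f_vine by (rule gauge_vine_density [OF V12_cont])
  show ?thesis
    unfolding is_gauge_function_def
  proof (intro conjI allI impI ballI)
    fix c :: real and x :: "real \<times> real \<times> real"
    assume "c > 0" and x: "x \<in> nonneg_orthant"
    then have "c *\<^sub>R x \<in> nonneg_orthant" by (auto simp: nonneg_orthant_def)
    then show "?g (c *\<^sub>R x) = c * ?g x"
      using x \<open>c > 0\<close> by (simp only: eq gauge_homogeneous)
  next
    show "continuous_on nonneg_orthant ?g"
      using * by (subst continuous_on_cong [OF refl eq]) (auto simp: is_gauge_function_def)
  next
    fix x :: "real \<times> real \<times> real"
    assume x: "x \<in> pos_orthant"
    then have "x \<in> nonneg_orthant" by (auto simp: pos_orthant_def nonneg_orthant_def)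
    then show "(\<lambda>t. - ln (f (t *\<^sub>R x))) \<sim>[at_top] (\<lambda>t. t * ?g x)"
      using * x by (simp only: eq is_gauge_function_def)
  qed
qed

end
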